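(* Let $\mathbf M = \langle Q \cup \Sigma \cup \{0\}; \cdot\rangle$ be a finite automatic algebra. If there exist $m \in \mathbb N$ and a permutation $\varphi$ of $\{1,2,\dots,m\}$ such that $\mathbf M$ fails the quasi-equation \[ xy_1y_2\cdots y_m \approx 0 \implies xy_{\varphi(1)}y_{\varphi(2)}\cdots y_{\varphi(m)} \approx 0, \] then $\mathbf M$ is inherently non-dualizable.
   Context: **Automatic algebras.** An automatic algebra is an algebra with a single binary operation $\mathbf M = \langle Q \cup \Sigma \cup \{0\}; \cdot\rangle$, where $Q$ (states) and $\Sigma$ (letters) are disjoint sets and $0 \notin Q\cup\Sigma$, that encodes a partial (deterministic) automaton: each letter $a \in \Sigma$ acts as a partial map $Q \to Q$; for $q,r\in Q$ and $a \in \Sigma$ we have $q\cdot a = r$ iff $a$ sends $q$ to $r$; all other products are $0$. Products are bracketed from the left: $uv_1v_2\cdots v_n := (\cdots((u\cdot v_1)\cdot v_2)\cdots)\cdot v_n$. In the quasi-equation, $0$ denotes the default element $0$ of $\mathbf M$ and the variables range over all of $M = Q\cup\Sigma\cup\{0\}$. $\mathbb N=\{1,2,3,\dots\}$. **Dualizability.** Let $\mathbf M$ be a finite algebra with universe $M$. A $k$-ary relation on $M$ ($k\ge 1$) is compatible with $\mathbf M$ if it is a subuniverse of $\mathbf M^k$. For $\mathbf A \in \mathbb{ISP}(\mathbf M)$ (isomorphic copies of subalgebras of powers of $\mathbf M$), view $\hom(\mathbf A,\mathbf M)\subseteq M^A$ with the subspace topology of the product topology ($M$ discrete), and with relations on $M$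 interpreted pointwise. A map $f\colon \hom(\mathbf A,\mathbf M)\to M$ is an evaluation if there is $a\in A$ with $f(x)=x(a)$ for all $x$. The algebra $\mathbf M$ is dualizable if, for every $\mathbf A\in\mathbb{ISP}(\mathbf M)$, every continuous map $f\colon\hom(\mathbf A,\mathbf M)\to M$ that preserves all finitary compatible relations on $\mathbf M$ is an evaluation. A finite algebra $\mathbf M$ is inherently non-dualizable if every finite algebra (of the same type) that has $\mathbf M$ as a subalgebra is non-dualizable. *)

theory Defs
  imports "HOL-Analysis.Analysis" "HOL-Combinatorics.Permutations" "HOL-Library.Infinite_Typeclass"
begin

section \<open>Algebras with a single binary operation\<close>

record 'a magma =
  univ :: "'a set"
  mul :: "'a \<Rightarrow> 'a \<Rightarrow> 'a"

text \<open>Algebras are non-empty.  The values of \<open>mul\<close> outside the universe are irrelevant.\<close>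

definition is_magma :: "'a magma \<Rightarrow> bool" where
  "is_magma M \<longleftrightarrow> univ M \<noteq> {} \<and> (\<forall>x\<in>univ M. \<forall>y\<in>univ M. mul M x y \<in> univ M)"

definition subuniverse :: "'a magma \<Rightarrow> 'a set \<Rightarrow> bool" where
  "subuniverse M B \<longleftrightarrow> B \<subseteq> univ M \<and> (\<forall>x\<in>B. \<forall>y\<in>B. mul M x y \<in> B)"

definition power_magma :: "'i set \<Rightarrow> 'a magma \<Rightarrow> ('i \<Rightarrow> 'a) magma" where
  "power_magma I M =
     \<lparr>univ = I \<rightarrow>\<^sub>E univ M, mul = (\<lambda>x y. \<lambda>i\<in>I. mul M (x i) (y i))\<rparr>"

definition homs :: "'a magma \<Rightarrow> 'b magma \<Rightarrow> ('a \<Rightarrow> 'b) set" where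
  "homs A M = {h \<in> univ A \<rightarrow>\<^sub>E univ M.
     \<forall>a\<in>univ A. \<forall>b\<in>univ A. h (mul A a b) = mul M (h a) (h b)}"

text \<open>An embedding is an isomorphism onto a subalgebra.\<close>

definition embeddings :: "'a magma \<Rightarrow> 'b magma \<Rightarrow> ('a \<Rightarrow> 'b) set" where
  "embeddings A M = {h \<in> homs A M. inj_on h (univ A)}"

text \<open>
  Index sets \<open>I\<close> of type \<^typ>\<open>('c \<Rightarrow> 'a) set\<close> are no restriction:
  if \<open>A\<close> embeds in a power of \<open>M\<close>, the coordinate maps of the embedding belong to
  \<open>homs A M\<close>, and repeated coordinate maps can be dropped.
\<close>

definition in_ISP :: "'c magma \<Rightarrow> 'a magma \<Rightarrow> bool" where
  "in_ISP A M \<longleftrightarrow> is_magma A \<and>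
     (\<exists>I :: ('c \<Rightarrow> 'a) set. embeddings A (power_magma I M) \<noteq> {})"


section \<open>Automatic algebras\<close>

text \<open>\<open>\<delta> a\<close> is the partial map on the states by which the letter \<open>a\<close> acts.\<close>

definition automatic_algebra :: "'a set \<Rightarrow> 'a set \<Rightarrow> 'a \<Rightarrow> 'a magma \<Rightarrow> bool" where
  "automatic_algebra Q S z M \<longleftrightarrow>
     Q \<inter> S = {} \<and> z \<notin> Q \<union> S \<and> univ M = Q \<union> S \<union> {z} \<and>
     (\<exists>\<delta> :: 'a \<Rightarrow> ('a \<rightharpoonup> 'a).
        (\<forall>a\<in>S. dom (\<delta> a) \<subseteq> Q \<and> ran (\<delta> a) \<subseteq> Q) \<and>
        (\<forall>x\<in>univ M. \<forall>y\<in>univ M. mul M x y =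
           (if x \<in> Q \<and> y \<in> S then (case \<delta> y x of Some r \<Rightarrow> r | None \<Rightarrow> z) else z)))"

text \<open>The left-bracketed product \<open>x y\<^sub>1 \<dots> y\<^sub>m\<close>.\<close>

definition left_prod :: "'a magma \<Rightarrow> nat \<Rightarrow> 'a \<Rightarrow> (nat \<Rightarrow> 'a) \<Rightarrow> 'a" where
  "left_prod M m x y = foldl (mul M) x (map y [1..<Suc m])"

text \<open>The quasi-equation \<open>x y\<^sub>1 \<dots> y\<^sub>m = z \<longrightarrow> x y\<^bsub>\<phi> 1\<^esub> \<dots> y\<^bsub>\<phi> m\<^esub> = z\<close> holds in \<open>M\<close>.\<close>

definition satisfies_perm_quasi_eq :: "'a magma \<Rightarrow> 'a \<Rightarrow> nat \<Rightarrow> (nat \<Rightarrow> nat) \<Rightarrow> bool" where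
  "satisfies_perm_quasi_eq M z m \<phi> \<longleftrightarrow>
     (\<forall>x\<in>univ M. \<forall>y\<in>{1..m} \<rightarrow> univ M.
        left_prod M m x y = z \<longrightarrow> left_prod M m x (\<lambda>i. y (\<phi> i)) = z)"


section \<open>Dualizability\<close>

text \<open>A \<open>k\<close>-ary relation is a set of functions in \<open>{..<k} \<rightarrow>\<^sub>E univ M\<close>.\<close>

definition compatible_relation :: "'a magma \<Rightarrow> nat \<Rightarrow> (nat \<Rightarrow> 'a) set \<Rightarrow> bool" where
  "compatible_relation M k R \<longleftrightarrow> k \<ge> 1 \<and> subuniverse (power_magma {..<k} M) R"

definition preserves_relation ::
    "'c magma \<Rightarrow> 'a magma \<Rightarrow> nat \<Rightarrow> (nat \<Rightarrow> 'a) set \<Rightarrow> (('c \<Rightarrow> 'a) \<Rightarrow> 'a) \<Rightarrow> bool" where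
  "preserves_relation A M k R f \<longleftrightarrow>
     (\<forall>x :: nat \<Rightarrow> 'c \<Rightarrow> 'a. (\<forall>i<k. x i \<in> homs A M) \<longrightarrow>
        (\<forall>a\<in>univ A. (\<lambda>i\<in>{..<k}. x i a) \<in> R) \<longrightarrow> (\<lambda>i\<in>{..<k}. f (x i)) \<in> R)"

definition homs_topology :: "'c magma \<Rightarrow> 'a magma \<Rightarrow> ('c \<Rightarrow> 'a) topology" where
  "homs_topology A M =
     subtopology (product_topology (\<lambda>a. discrete_topology (univ M)) (univ A)) (homs A M)"

definition is_evaluation :: "'c magma \<Rightarrow> 'a magma \<Rightarrow> (('c \<Rightarrow> 'a) \<Rightarrow> 'a) \<Rightarrow> bool" where
  "is_evaluation A M f \<longleftrightarrow> (\<exists>a\<in>univ A. \<forall>x\<in>homs A M. f x = x a)"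

text \<open>
  The algebras \<open>A\<close> in ISP(M) range over a proper class; a definition in HOL has to fix the type
  \<^typ>\<open>'c\<close> of their elements.  Any infinite type yields the same notion.  For suppose that
  a continuous \<open>f\<close> preserving all compatible relations is not an evaluation on some \<open>A\<close>, of
  any size.  As \<open>homs A M\<close> is compact (\<open>M\<close> being finite), \<open>f\<close> depends only on the restrictions
  of homomorphisms to a finite \<open>F \<subseteq> univ A\<close>.  By compactness again there is a countable subalgebra
  \<open>A' \<supseteq> F\<close> such that, for every compatible relation \<open>R\<close> of \<open>M\<close> (there are countably many),
  homomorphisms from \<open>A'\<close> and from \<open>A\<close> into the subalgebra \<open>R\<close> of a power of \<open>M\<close> have the
  same restrictions to \<open>F\<close>; so \<open>f\<close> induces a continuous map for \<open>A'\<close> that preserves all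
  compatible relations and is not an evaluation.  For \<open>M\<close> to be non-dualizable with respect to
  any one \<^typ>\<open>'c\<close> thus is no weaker, and no stronger, than to be non-dualizable.
\<close>

definition dualizable :: "'c::infinite itself \<Rightarrow> 'a magma \<Rightarrow> bool" where
  "dualizable (_ :: 'c itself) M \<longleftrightarrow>
     (\<forall>(A :: 'c magma) f. in_ISP A M \<longrightarrow>
        continuous_map (homs_topology A M) (discrete_topology (univ M)) f \<longrightarrow>
        (\<forall>k R. compatible_relation M k R \<longrightarrow> preserves_relation A M k R f) \<longrightarrow>
        is_evaluation A M f)"

text \<open>
  The finite extensions \<open>N\<close> of \<open>M\<close> likewise need a type \<^typ>\<open>'b\<close> of elements.  It need not be
  the type of \<open>M\<close> (which may have no room for them), so \<open>N\<close> contains a copy of \<open>M\<close> as a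
  subalgebra.  Every finite algebra has a copy on any infinite \<^typ>\<open>'b\<close>.
\<close>

definition inherently_non_dualizable ::
    "'b itself \<Rightarrow> 'c::infinite itself \<Rightarrow> 'a magma \<Rightarrow> bool" where
  "inherently_non_dualizable (_ :: 'b itself) (c :: 'c itself) M \<longleftrightarrow>
     (\<forall>N :: 'b magma. is_magma N \<longrightarrow> finite (univ N) \<longrightarrow> embeddings M N \<noteq> {} \<longrightarrow>
        \<not> dualizable c N)"

end

theory Submission
  imports Defs
begin

text \<open>
  A finite algebra \<open>N\<close> is not dualizable as soon as the following obstruction exists: an algebra
  \<open>A\<close> in ISP(N) and elements \<open>v 0, v 1, \<dots>\<close> of \<open>A\<close> such that each homomorphism from \<open>A\<close> to \<open>N\<close> is
  constant on the \<open>v n\<close> up to a bounded number of exceptions, while no element of \<open>A\<close> takes this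
  generic value under all homomorphisms.  Sending a homomorphism to its generic value is then
  continuous, because finitely many \<open>v n\<close> determine it by majority, and it preserves all compatible
  relations, because any finitely many homomorphisms are simultaneously generic at some \<open>v n\<close>; but
  it is not an evaluation.  If \<open>A\<close> is a subalgebra of a power of \<open>M\<close> and the bound holds for
  homomorphisms into an arbitrary finite algebra, then every finite extension of \<open>M\<close> is
  non-dualizable.

  The bound is a matter of identities between products in \<open>A\<close>.  A homomorphism into a
  finite algebra colours the indices with finitely many colours, according to the images of
  the generators with that index.  The image of a product is not changed when an index is
  replaced by one of the same colour, and the identities are chosen such that replacements of this
  kind lead from \<open>v n\<close> to \<open>v m\<close> whenever the colours of \<open>n\<close> and \<open>m\<close> occur often enough
  (\<open>inherently_non_dualizable_if_generic_value_not_attained\<close>).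

  For a finite automatic algebra \<open>M\<close> there are two constructions.

  If \<open>M\<close> satisfies no law \<open>x y\<^bsup>e+1\<^esup> = x y\<close> with \<open>e \<ge> 1\<close>, generators are \<open>x\<close>'s, indexed by pairs, and
  \<open>y\<close>'s, indexed by numbers, and the products \<open>x y\<close> are
  identified along a partition into rectangles: the product of \<open>x\<^bsub>ik\<^esub>\<close> with \<open>y\<^bsub>j\<^esub>\<close> depends only on
  \<open>j\<close> if \<open>j \<in> {i, k}\<close>, and only on \<open>(i, k)\<close> otherwise.  An element with generic values would have to
  be a word \<open>x y \<dots> y\<close> of length other than 2 that equals \<open>x y\<close> for all values in \<open>M\<close>, which is such a
  law or would imply one (\<open>inherently_non_dualizable_if_no_power_law\<close>).

  If \<open>q\<^bsub>1\<^esub> A C = q\<^bsub>2\<^esub> B C \<noteq> 0\<close> but \<open>q\<^bsub>1\<^esub> B C = 0\<close>, for words \<open>A\<close>, \<open>B\<close> of equal length and \<open>C\<close>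
  non-empty, a second construction applies
  (\<open>inherently_non_dualizable_if_not_rectangular\<close>).

  If neither construction applies, letters can be permuted: suppose \<open>x V = r \<noteq> 0\<close> and let \<open>D\<close> be a
  rearrangement of \<open>V\<close>.  The power law supplies loops at every state with an incoming letter, and
  the absence of the second configuration lets one trade a path for such a loop.
  So every word in the letters of \<open>V\<close> can be read from \<open>r\<close>, in particular \<open>D D D \<dots>\<close>,
  which eventually runs in a cycle; comparing the cycle with \<open>x V\<close> gives \<open>x D \<noteq> 0\<close>
  (\<open>letters_permute_if_rectangular\<close>).  Hence if the quasi-equation fails, one of the two constructions
  is available.
\<close>

section \<open>Generic values as an obstruction to duality\<close>

text \<open>
  The bound \<open>u\<close> must be uniform in \<open>h\<close>: it makes \<open>2 * u + 1\<close> of the \<open>v n\<close> enough to determine the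
  generic value, since two homomorphisms that agree on them have at most \<open>2 * u\<close> exceptions between
  them.  Finiteness of the exceptional sets alone would give preservation of the relations, but not
  continuity.
\<close>

lemma not_dualizable_if_generic_value_not_attained:
  fixes A :: "'c::infinite magma" and N :: "'b magma" and v :: "nat \<Rightarrow> 'c" and u :: nat
  assumes A: "is_magma A"
    and separate: "\<And>a b. a \<in> univ A \<Longrightarrow> b \<in> univ A \<Longrightarrow> a \<noteq> b \<Longrightarrow> \<exists>h\<in>homs A N. h a \<noteq> h b"
    and v: "\<And>n. v n \<in> univ A"
    and bound: "\<And>h. h \<in> homs A N \<Longrightarrow>
      \<exists>c. finite {n. h (v n) \<noteq> c} \<and> card {n. h (v n) \<noteq> c} \<le> u"
    and not_attained: "\<And>a. a \<in> univ A \<Longrightarrow> \<exists>h\<in>homs A N. infinite {n. h (v n) \<noteq> h a}"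
  shows "\<not> dualizable TYPE('c) N"
proof
  assume dual: "dualizable TYPE('c) N"
  \<comment> \<open>the map that sends a homomorphism to its generic value\<close>
  define f where "f h = (SOME c. finite {n. h (v n) \<noteq> c} \<and> card {n. h (v n) \<noteq> c} \<le> u)"
    for h :: "'c \<Rightarrow> 'b"
  have f: "finite {n. h (v n) \<noteq> f h} \<and> card {n. h (v n) \<noteq> f h} \<le> u" if "h \<in> homs A N" for h
    unfolding f_def by (rule someI_ex) (rule bound[OF that])
  have f_attained: "\<exists>n. h (v n) = f h" if "h \<in> homs A N" for h
    using f[OF that] ex_new_if_finite[OF infinite_UNIV_nat, of "{n. h (v n) \<noteq> f h}"] by auto
  have f_in: "f h \<in> univ N" if h: "h \<in> homs A N" for h
  proof -
    obtain n where "h (v n) = f h"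
      using f_attained[OF h] by blast
    moreover have "h (v n) \<in> univ N" using h v[of n] unfolding homs_def by blast
    ultimately show ?thesis by simp
  qed

  have f_eq: "f h = f h'"
    if h: "h \<in> homs A N" and h': "h' \<in> homs A N" and agree: "\<forall>n\<le>2*u. h (v n) = h' (v n)" for h h'
  proof -
    let ?E = "{n. h (v n) \<noteq> f h} \<union> {n. h' (v n) \<noteq> f h'}"
    have "card ?E \<le> 2 * u"
      using card_Un_le[of "{n. h (v n) \<noteq> f h}" "{n. h' (v n) \<noteq> f h'}"] f[OF h] f[OF h'] by simp
    then have "\<not> {..2*u} \<subseteq> ?E"
      using card_mono[of ?E "{..2*u}"] f[OF h] f[OF h'] by auto
    then show ?thesis using agree by auto
  qed

  have top: "topspace (homs_topology A N) = homs A N"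
  proof -
    have "homs A N \<subseteq> univ A \<rightarrow>\<^sub>E univ N" unfolding homs_def by blast
    then show ?thesis
      unfolding homs_topology_def topspace_subtopology topspace_product_topology by simp blast
  qed
  have continuous: "continuous_map (homs_topology A N) (discrete_topology (univ N)) f"
    unfolding continuous_map_def
  proof (intro conjI allI impI)
    show "f \<in> topspace (homs_topology A N) \<rightarrow> topspace (discrete_topology (univ N))"
      using f_in by (auto simp: top)
  next
    fix U assume "openin (discrete_topology (univ N)) U"
    show "openin (homs_topology A N) {h \<in> topspace (homs_topology A N). f h \<in> U}"
    proof (subst openin_subopen, intro ballI)
      fix h assume h: "h \<in> {h \<in> topspace (homs_topology A N). f h \<in> U}"
      then have hom: "h \<in> homs A N" by (simp add: top)
      have cont: "continuous_map (homs_topology A N) (discrete_topology (univ N)) (\<lambda>h. h (v n))" for n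
        unfolding homs_topology_def
        by (intro continuous_map_from_subtopology continuous_map_product_projection v)
      have "openin (homs_topology A N) {h' \<in> topspace (homs_topology A N). h' (v n) \<in> {h (v n)}}" for n
      proof (rule openin_continuous_map_preimage[OF cont])
        have "h (v n) \<in> univ N"
          using hom v unfolding homs_def by blast
        then show "openin (discrete_topology (univ N)) {h (v n)}" by simp
      qed
      then have "openin (homs_topology A N)
          (\<Inter>n\<in>{..2*u}. {h' \<in> topspace (homs_topology A N). h' (v n) \<in> {h (v n)}})"
        by (intro openin_INT2) auto
      moreover have "h \<in> (\<Inter>n\<in>{..2*u}. {h' \<in> topspace (homs_topology A N). h' (v n) \<in> {h (v n)}})"
        using hom by (simp add: top)
      moreover have "(\<Inter>n\<in>{..2*u}. {h' \<in> topspace (homs_topology A N). h' (v n) \<in> {h (v n)}})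
          \<subseteq> {h \<in> topspace (homs_topology A N). f h \<in> U}"
      proof
        fix h' assume h': "h' \<in> (\<Inter>n\<in>{..2*u}. {h' \<in> topspace (homs_topology A N). h' (v n) \<in> {h (v n)}})"
        then have "h' \<in> homs A N" "\<forall>n\<le>2*u. h (v n) = h' (v n)"
          by (auto simp: top)
        then show "h' \<in> {h \<in> topspace (homs_topology A N). f h \<in> U}"
          using f_eq[OF hom] h by (auto simp: top)
      qed
      ultimately show "\<exists>T. openin (homs_topology A N) T \<and> h \<in> T \<and>
          T \<subseteq> {h \<in> topspace (homs_topology A N). f h \<in> U}"
        by blast
    qed
  qed

  have preserves: "preserves_relation A N k R f" for k and R
    unfolding preserves_relation_def
  proof (intro allI impI)
    fix x :: "nat \<Rightarrow> 'c \<Rightarrow> 'b"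
    assume x: "\<forall>i<k. x i \<in> homs A N" and R: "\<forall>a\<in>univ A. (\<lambda>i\<in>{..<k}. x i a) \<in> R"
    have "finite (\<Union>i<k. {n. x i (v n) \<noteq> f (x i)})"
      using x f by auto
    then obtain n where "n \<notin> (\<Union>i<k. {n. x i (v n) \<noteq> f (x i)})"
      using ex_new_if_finite infinite_UNIV_nat by blast
    then have "(\<lambda>i\<in>{..<k}. f (x i)) = (\<lambda>i\<in>{..<k}. x i (v n))"
      by (auto simp: restrict_def)
    then show "(\<lambda>i\<in>{..<k}. f (x i)) \<in> R"
      using R v by simp
  qed

  \<comment> \<open>all homomorphisms serve as coordinates, and they separate points\<close>
  have "in_ISP A N"
  proof -
    define e where "e = (\<lambda>a\<in>univ A. \<lambda>h\<in>homs A N. h a)"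
    have mulA: "mul A a b \<in> univ A" if "a \<in> univ A" "b \<in> univ A" for a b
      using A that by (auto simp: is_magma_def)
    have "e \<in> homs A (power_magma (homs A N) N)"
      unfolding homs_def[of A "power_magma (homs A N) N"]
    proof (intro CollectI conjI ballI)
      have "h a \<in> univ N" if "h \<in> homs A N" "a \<in> univ A" for h a
        using that unfolding homs_def by blast
      then show "e \<in> univ A \<rightarrow>\<^sub>E univ (power_magma (homs A N) N)"
        unfolding e_def power_magma_def by simp
    next
      fix a b assume ab: "a \<in> univ A" "b \<in> univ A"
      show "e (mul A a b) = mul (power_magma (homs A N) N) (e a) (e b)"
      proof -
        have "e (mul A a b) = (\<lambda>h\<in>homs A N. h (mul A a b))"
          using ab mulA by (simp add: e_def)
        also have "\<dots> = (\<lambda>h\<in>homs A N. mul N (h a) (h b))"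
          using ab by (intro restrict_ext) (simp add: homs_def)
        also have "\<dots> = mul (power_magma (homs A N) N) (e a) (e b)"
          using ab by (simp add: e_def power_magma_def cong: restrict_cong)
        finally show ?thesis .
      qed
    qed
    moreover have "inj_on e (univ A)"
    proof (rule inj_onI, rule ccontr)
      fix a b assume ab: "a \<in> univ A" "b \<in> univ A" "e a = e b" "a \<noteq> b"
      then obtain h where "h \<in> homs A N" "h a \<noteq> h b"
        using separate by blast
      moreover from this ab have "e a h = e b h" by simp
      ultimately show False using ab by (simp add: e_def)
    qed
    ultimately have "embeddings A (power_magma (homs A N) N) \<noteq> {}"
      by (auto simp: embeddings_def)
    then show ?thesis using A by (auto simp: in_ISP_def)
  qed
  then have "is_evaluation A N f"
    using dual continuous preserves unfolding dualizable_def by blast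
  then obtain a where a: "a \<in> univ A" "\<forall>h\<in>homs A N. f h = h a"
    by (auto simp: is_evaluation_def)
  moreover obtain h where "h \<in> homs A N" "infinite {n. h (v n) \<noteq> h a}"
    using not_attained[OF a(1)] by blast
  ultimately show False
    using f[of h] by simp
qed

lemma homs_restrict_compose:
  assumes "h \<in> homs A N" and "g \<in> homs B A" and "is_magma B"
  shows "(\<lambda>b\<in>univ B. h (g b)) \<in> homs B N"
  using assms by (auto simp: homs_def is_magma_def PiE_iff)

text \<open>
  Dualizability speaks of algebras on one fixed infinite type; a countable algebra of any type has
  an isomorphic copy there.
\<close>

lemma not_dualizable_if_generic_value_not_attained_countable:
  fixes A :: "'d magma" and N :: "'b magma" and v :: "nat \<Rightarrow> 'd" and u :: nat
  assumes A: "is_magma A" and countable: "countable (univ A)"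
    and separate: "\<And>a b. a \<in> univ A \<Longrightarrow> b \<in> univ A \<Longrightarrow> a \<noteq> b \<Longrightarrow> \<exists>h\<in>homs A N. h a \<noteq> h b"
    and v: "\<And>n. v n \<in> univ A"
    and bound: "\<And>h. h \<in> homs A N \<Longrightarrow>
      \<exists>c. finite {n. h (v n) \<noteq> c} \<and> card {n. h (v n) \<noteq> c} \<le> u"
    and not_attained: "\<And>a. a \<in> univ A \<Longrightarrow> \<exists>h\<in>homs A N. infinite {n. h (v n) \<noteq> h a}"
  shows "\<not> dualizable TYPE('c::infinite) N"
proof -
  obtain s :: "nat \<Rightarrow> 'c" where s: "inj s"
    using infinite_countable_subset[OF infinite_UNIV] by auto
  obtain t :: "'d \<Rightarrow> nat" where t: "inj_on t (univ A)"
    using countable by (auto simp: countable_def)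
  define g where "g = s \<circ> t"
  have g: "inj_on g (univ A)"
    unfolding g_def using s t by (metis comp_inj_on inj_on_subset subset_UNIV)
  define g' where "g' = the_inv_into (univ A) g"
  have g'g[simp]: "g' (g a) = a" if "a \<in> univ A" for a
    unfolding g'_def using g that by (rule the_inv_into_f_f)
  define A' where "A' = \<lparr>univ = g ` univ A, mul = (\<lambda>x y. g (mul A (g' x) (g' y)))\<rparr>"
  have A': "is_magma A'"
    using A by (auto simp: A'_def is_magma_def)
  have univA': "univ A' = g ` univ A" by (simp add: A'_def)
  have hg: "(\<lambda>a\<in>univ A. g a) \<in> homs A A'" and hg': "(\<lambda>x\<in>univ A'. g' x) \<in> homs A' A"
    using A by (auto simp: A'_def homs_def is_magma_def)
  have pull: "\<exists>h\<in>homs A N. \<forall>a\<in>univ A. h a = h' (g a)" if "h' \<in> homs A' N" for h'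
    using homs_restrict_compose[OF that hg A] by (intro bexI) auto
  have push: "\<exists>h'\<in>homs A' N. \<forall>a\<in>univ A. h a = h' (g a)" if "h \<in> homs A N" for h
    using homs_restrict_compose[OF that hg' A'] by (intro bexI) (auto simp: univA')
  show ?thesis
  proof (rule not_dualizable_if_generic_value_not_attained[OF A', where v = "\<lambda>n. g (v n)" and u = u])
    fix a b assume "a \<in> univ A'" "b \<in> univ A'" "a \<noteq> b"
    then obtain a0 b0 where ab: "a = g a0" "b = g b0" "a0 \<in> univ A" "b0 \<in> univ A" "a0 \<noteq> b0"
      by (auto simp: univA')
    then obtain h where "h \<in> homs A N" "h a0 \<noteq> h b0" using separate by blast
    moreover from this obtain h' where "h' \<in> homs A' N" "\<forall>a\<in>univ A. h a = h' (g a)"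
      using push[of h] by blast
    ultimately have "h' a \<noteq> h' b" using ab by simp
    then show "\<exists>h\<in>homs A' N. h a \<noteq> h b" using \<open>h' \<in> homs A' N\<close> by blast
  next
    show "g (v n) \<in> univ A'" for n using v by (simp add: univA')
  next
    fix h' assume "h' \<in> homs A' N"
    then obtain h where h: "h \<in> homs A N" "\<forall>a\<in>univ A. h a = h' (g a)" using pull by blast
    then have "h' (g (v n)) = h (v n)" for n using v by simp
    then show "\<exists>c. finite {n. h' (g (v n)) \<noteq> c} \<and> card {n. h' (g (v n)) \<noteq> c} \<le> u"
      using bound[OF h(1)] by simp
  next
    fix a assume "a \<in> univ A'"
    then obtain a0 where a0: "a = g a0" "a0 \<in> univ A" by (auto simp: univA')
    obtain h where h: "h \<in> homs A N" "infinite {n. h (v n) \<noteq> h a0}"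
      using not_attained[OF a0(2)] by blast
    obtain h' where h': "h' \<in> homs A' N" "\<forall>a\<in>univ A. h a = h' (g a)" using push[OF h(1)] by blast
    have "h' (g (v n)) = h (v n)" for n using v h' by simp
    then show "\<exists>h\<in>homs A' N. infinite {n. h (g (v n)) \<noteq> h a}"
      using h h' a0 by (intro bexI[of _ h']) auto
  qed
qed

lemma rare_colours:
  fixes f :: "nat \<Rightarrow> 'e" and k :: nat
  assumes C: "finite C" and f: "range f \<subseteq> C"
  defines "B \<equiv> {n. finite {m. f m = f n} \<and> card {m. f m = f n} \<le> k}"
  shows "finite B" and "card B \<le> k * card C"
proof -
  define D where "D = {c \<in> C. finite (f -` {c}) \<and> card (f -` {c}) \<le> k}"
  have B: "B = (\<Union>c\<in>D. f -` {c})"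
  proof (intro equalityI subsetI)
    fix n assume "n \<in> B"
    then have "f n \<in> D"
      using f unfolding B_def D_def by (auto simp: vimage_def)
    then show "n \<in> (\<Union>c\<in>D. f -` {c})" by blast
  next
    fix n assume "n \<in> (\<Union>c\<in>D. f -` {c})"
    then have "f n \<in> D" by blast
    then show "n \<in> B"
      unfolding B_def D_def by (simp add: vimage_def)
  qed
  have D: "finite D" "card D \<le> card C"
    using C unfolding D_def by (simp, intro card_mono) auto
  show "finite B" unfolding B by (rule finite_UN_I[OF D(1)]) (simp add: D_def)
  have "card B \<le> (\<Sum>c\<in>D. card (f -` {c}))" unfolding B by (rule card_UN_le[OF D(1)])
  also have "\<dots> \<le> (\<Sum>c\<in>D. k)" by (rule sum_mono) (simp add: D_def)
  also have "\<dots> \<le> k * card C" using D by simp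
  finally show "card B \<le> k * card C" .
qed

text \<open>
  Exceptions have colours that occur at most twice: an index \<open>n\<close> whose colour occurs three times
  has, for every \<open>m\<close>, a companion of the same colour outside \<open>{n, m}\<close>.
\<close>

lemma few_exceptions_if_colours_link:
  fixes g :: "nat \<Rightarrow> 'b" and f :: "nat \<Rightarrow> 'e"
  assumes C: "finite C" and f: "range f \<subseteq> C"
    and link: "\<And>n m n' m'. \<lbrakk>n \<noteq> m; n' \<notin> {n, m}; m' \<notin> {n, m}; f n' = f n; f m' = f m\<rbrakk> \<Longrightarrow> g n = g m"
  shows "\<exists>c. finite {n. g n \<noteq> c} \<and> card {n. g n \<noteq> c} \<le> 2 * card C"
proof -
  define B where "B = {n. finite {m. f m = f n} \<and> card {m. f m = f n} \<le> 2}"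
  note B = rare_colours[OF C f, of 2, folded B_def]
  have twin: "\<exists>n'. n' \<notin> {n, m} \<and> f n' = f n" if "n \<notin> B" for n m
  proof (rule ccontr)
    assume "\<nexists>n'. n' \<notin> {n, m} \<and> f n' = f n"
    then have *: "{n'. f n' = f n} \<subseteq> {n, m}" by auto
    then have "finite {n'. f n' = f n}" "card {n'. f n' = f n} \<le> card {n, m}"
      by (auto intro: finite_subset card_mono)
    moreover have "card {n, m} \<le> 2" by (simp add: card_insert_if)
    ultimately show False using that by (auto simp: B_def)
  qed
  obtain n0 where n0: "n0 \<notin> B" using ex_new_if_finite[OF infinite_UNIV_nat B(1)] by blast
  have "g n = g n0" if n: "n \<notin> B" for n
  proof (cases "n = n0")
    case False
    obtain n' where "n' \<notin> {n, n0}" "f n' = f n" using twin[OF n] by blast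
    moreover obtain m' where "m' \<notin> {n0, n}" "f m' = f n0" using twin[OF n0] by blast
    ultimately show ?thesis using link[OF False, of n' m'] by auto
  qed simp
  then have "{n. g n \<noteq> g n0} \<subseteq> B" by auto
  then show ?thesis using B finite_subset card_mono by (meson order.trans)
qed

section \<open>Subalgebras generated in a power\<close>

inductive_set generated :: "'a magma \<Rightarrow> ('i \<Rightarrow> 'a) set \<Rightarrow> ('i \<Rightarrow> 'a) set"
  for M :: "'a magma" and G :: "('i \<Rightarrow> 'a) set" where
  gen: "g \<in> G \<Longrightarrow> g \<in> generated M G"
| prod: "f \<in> generated M G \<Longrightarrow> g \<in> generated M G \<Longrightarrow> (\<lambda>i. mul M (f i) (g i)) \<in> generated M G"

definition generated_magma :: "'a magma \<Rightarrow> ('i \<Rightarrow> 'a) set \<Rightarrow> ('i \<Rightarrow> 'a) magma" where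
  "generated_magma M G = \<lparr>univ = generated M G, mul = (\<lambda>f g i. mul M (f i) (g i))\<rparr>"

lemma countable_generated:
  fixes M :: "'a magma" and G :: "('i \<Rightarrow> 'a) set"
  assumes "countable G"
  shows "countable (generated M G)"
proof -
  define step where "step F = F \<union> (\<lambda>(f, g) i. mul M (f i) (g i)) ` (F \<times> F)" for F :: "('i \<Rightarrow> 'a) set"
  define st where "st n = (step ^^ n) G" for n
  have "countable (st n)" for n
    by (induction n) (simp_all add: st_def step_def assms)
  moreover have "f \<in> (\<Union>n. st n)" if "f \<in> generated M G" for f
    using that
  proof induction
    case (gen g)
    then have "g \<in> st 0" by (simp add: st_def)
    then show ?case by blast
  next
    case (prod f g)
    have mono: "st n \<subseteq> st (n + k)" for n k
      by (induction k) (auto simp: st_def step_def)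
    obtain n m where "f \<in> st n" "g \<in> st m" using prod by blast
    then have "f \<in> st (n + m)" "g \<in> st (n + m)"
      using mono[of n m] mono[of m n] by (auto simp: add.commute)
    then have "(\<lambda>i. mul M (f i) (g i)) \<in> st (Suc (n + m))" by (auto simp: st_def step_def)
    then show ?case by blast
  qed
  ultimately show ?thesis
    by (intro countable_subset[of "generated M G" "\<Union>n. st n"] countable_UN) auto
qed

text \<open>
  The criterion for a subalgebra of a power of \<open>M\<close>.  A projection followed by an embedding of \<open>M\<close>
  is a homomorphism to the extension \<open>N\<close>; these projections separate points and suffice to see
  that generic values are not attained.  Only the linking condition concerns all
  homomorphisms to \<open>N\<close>, and its colour set may depend on \<open>N\<close>.
\<close>

lemma inherently_non_dualizable_if_generic_value_not_attained:
  fixes M :: "'a magma" and G :: "('i \<Rightarrow> 'a) set" and v :: "nat \<Rightarrow> 'i \<Rightarrow> 'a"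
  assumes M: "is_magma M" and G: "countable G" "\<And>g i. g \<in> G \<Longrightarrow> g i \<in> univ M"
    and v: "\<And>n. v n \<in> generated M G"
    and link: "\<And>N :: 'b magma. is_magma N \<Longrightarrow> finite (univ N) \<Longrightarrow>
      \<exists>C :: 'e set. finite C \<and> (\<forall>h\<in>homs (generated_magma M G) N. \<exists>f. range f \<subseteq> C \<and>
        (\<forall>n m n' m'. n \<noteq> m \<longrightarrow> n' \<notin> {n, m} \<longrightarrow> m' \<notin> {n, m} \<longrightarrow> f n' = f n \<longrightarrow> f m' = f m \<longrightarrow>
          h (v n) = h (v m)))"
    and not_attained: "\<And>f. f \<in> generated M G \<Longrightarrow> \<exists>i. infinite {n. v n i \<noteq> f i}"
  shows "inherently_non_dualizable TYPE('b) TYPE('c::infinite) M"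
  unfolding inherently_non_dualizable_def
proof (intro allI impI)
  fix N :: "'b magma"
  assume N: "is_magma N" "finite (univ N)" and "embeddings M N \<noteq> {}"
  then obtain e where e: "e \<in> homs M N" "inj_on e (univ M)" by (auto simp: embeddings_def)
  let ?A = "generated_magma M G"
  have A: "is_magma ?A"
    using v by (auto simp: is_magma_def generated_magma_def intro: generated.prod)
  have in_M: "f i \<in> univ M" if "f \<in> univ ?A" for f i
  proof -
    have "f \<in> generated M G" using that by (simp add: generated_magma_def)
    then show ?thesis by induction (use G M in \<open>auto simp: is_magma_def\<close>)
  qed
  define p where "p i = (\<lambda>f\<in>univ ?A. e (f i))" for i
  have p: "p i \<in> homs ?A N" for i
  proof -
    have "(\<lambda>f\<in>univ ?A. f i) \<in> homs ?A M"
      using A in_M by (auto simp: homs_def is_magma_def generated_magma_def)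
    from homs_restrict_compose[OF e(1) this A]
    have "(\<lambda>f\<in>univ ?A. e ((\<lambda>f\<in>univ ?A. f i) f)) \<in> homs ?A N" .
    also have "(\<lambda>f\<in>univ ?A. e ((\<lambda>f\<in>univ ?A. f i) f)) = p i"
      unfolding p_def by (rule restrict_ext) simp
    finally show ?thesis .
  qed
  have p_eq: "p i f = p i g \<longleftrightarrow> f i = g i" if "f \<in> univ ?A" "g \<in> univ ?A" for f g i
    using that in_M inj_onD[OF e(2)] by (auto simp: p_def)
  have vA: "v n \<in> univ ?A" for n using v by (simp add: generated_magma_def)
  from link[OF N] obtain C :: "'e set" where C: "finite C"
    and h: "\<And>h. h \<in> homs ?A N \<Longrightarrow> \<exists>f. range f \<subseteq> C \<and>
        (\<forall>n m n' m'. n \<noteq> m \<longrightarrow> n' \<notin> {n, m} \<longrightarrow> m' \<notin> {n, m} \<longrightarrow> f n' = f n \<longrightarrow> f m' = f m \<longrightarrow>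
          h (v n) = h (v m))" by blast
  show "\<not> dualizable TYPE('c) N"
  proof (rule not_dualizable_if_generic_value_not_attained_countable
      [OF A, where v = v and u = "2 * card C"])
    show "countable (univ ?A)" using countable_generated[OF G(1)] by (simp add: generated_magma_def)
  next
    fix f g assume fg: "f \<in> univ ?A" "g \<in> univ ?A" "f \<noteq> g"
    then obtain i where "f i \<noteq> g i" by blast
    then show "\<exists>h\<in>homs ?A N. h f \<noteq> h g" using p p_eq fg by blast
  next
    show "v n \<in> univ ?A" for n by (rule vA)
  next
    fix h assume hom: "h \<in> homs ?A N"
    from h[OF this] obtain f where f: "range f \<subseteq> C"
      and l: "\<And>n m n' m'. \<lbrakk>n \<noteq> m; n' \<notin> {n, m}; m' \<notin> {n, m}; f n' = f n; f m' = f m\<rbrakk> \<Longrightarrow>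
          h (v n) = h (v m)" by blast
    show "\<exists>c. finite {n. h (v n) \<noteq> c} \<and> card {n. h (v n) \<noteq> c} \<le> 2 * card C"
      by (rule few_exceptions_if_colours_link[OF C f]) (rule l)
  next
    fix f assume f: "f \<in> univ ?A"
    then obtain i where "infinite {n. v n i \<noteq> f i}"
      using not_attained by (auto simp: generated_magma_def)
    then have "infinite {n. p i (v n) \<noteq> p i f}" using p_eq[OF vA f] by simp
    then show "\<exists>h\<in>homs ?A N. infinite {n. h (v n) \<noteq> h f}" using p by blast
  qed
qed

lemma generated_word:
  assumes "f \<in> generated M G" and "set gs \<subseteq> G"
  shows "(\<lambda>i. foldl (mul M) (f i) (map (\<lambda>g. g i) gs)) \<in> generated M G"
  using assms
proof (induction gs rule: rev_induct)
  case (snoc g gs)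
  then show ?case using generated.prod[OF snoc.IH generated.gen, of g] by simp
qed simp

lemma hom_word:
  assumes h: "h \<in> homs (generated_magma M G) N" and f: "f \<in> generated M G" and gs: "set gs \<subseteq> G"
  shows "h (\<lambda>i. foldl (mul M) (f i) (map (\<lambda>g. g i) gs)) = foldl (mul N) (h f) (map h gs)"
  using gs
proof (induction gs rule: rev_induct)
  case (snoc g gs)
  have "h (\<lambda>i. mul M (foldl (mul M) (f i) (map (\<lambda>g. g i) gs)) (g i)) =
      mul N (h (\<lambda>i. foldl (mul M) (f i) (map (\<lambda>g. g i) gs))) (h g)"
    using h generated_word[OF f, of gs] generated.gen[of g G M] snoc.prems
    by (auto simp: homs_def generated_magma_def)
  then show ?case using snoc by simp
qed simp

section \<open>Words acting on an automatic algebra\<close>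

locale automatic =
  fixes Q S :: "'a set" and z :: 'a and M :: "'a magma"
  assumes automatic: "automatic_algebra Q S z M"
begin

abbreviation act :: "'a \<Rightarrow> 'a list \<Rightarrow> 'a" where
  "act \<equiv> foldl (mul M)"

lemma univ_eq: "univ M = Q \<union> S \<union> {z}" and Q_S: "Q \<inter> S = {}" and zero: "z \<notin> Q" "z \<notin> S"
  using automatic by (auto simp: automatic_algebra_def)

lemma mul_cases:
  assumes "x \<in> univ M" and "y \<in> univ M"
  shows "mul M x y = z \<or> x \<in> Q \<and> y \<in> S \<and> mul M x y \<in> Q"
proof -
  from automatic obtain \<delta> :: "'a \<Rightarrow> 'a \<rightharpoonup> 'a" where
    "\<forall>a\<in>S. dom (\<delta> a) \<subseteq> Q \<and> ran (\<delta> a) \<subseteq> Q"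
    and "\<forall>x\<in>univ M. \<forall>y\<in>univ M. mul M x y =
           (if x \<in> Q \<and> y \<in> S then (case \<delta> y x of Some r \<Rightarrow> r | None \<Rightarrow> z) else z)"
    by (auto simp: automatic_algebra_def)
  note \<delta> = this
  show ?thesis
  proof (cases "x \<in> Q \<and> y \<in> S \<and> \<delta> y x \<noteq> None")
    case True
    then obtain r where r: "\<delta> y x = Some r" by auto
    then have "r \<in> Q" using \<delta>(1) True by (auto intro: ranI)
    then show ?thesis using \<delta>(2) assms True r by simp
  next
    case False
    then show ?thesis using \<delta>(2) assms by (auto split: option.splits)
  qed
qed

lemma mul_closed [simp]: "x \<in> univ M \<Longrightarrow> y \<in> univ M \<Longrightarrow> mul M x y \<in> univ M"
  using mul_cases[of x y] by (auto simp: univ_eq)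

lemma zero_in [simp]: "z \<in> univ M"
  by (simp add: univ_eq)

lemma mul_zero [simp]: "x \<in> univ M \<Longrightarrow> mul M x z = z" "y \<in> univ M \<Longrightarrow> mul M z y = z"
  using mul_cases[of x z] mul_cases[of z y] zero by auto

lemma is_magma: "is_magma M"
  unfolding is_magma_def using mul_closed zero_in by blast

lemma act_closed [simp]: "x \<in> univ M \<Longrightarrow> set w \<subseteq> univ M \<Longrightarrow> act x w \<in> univ M"
  by (induction w rule: rev_induct) auto

lemma act_zero [simp]: "set w \<subseteq> univ M \<Longrightarrow> act z w = z"
  by (induction w rule: rev_induct) auto

lemma act_zero_letter: "x \<in> univ M \<Longrightarrow> set w \<subseteq> univ M \<Longrightarrow> z \<in> set w \<Longrightarrow> act x w = z"
  by (induction w rule: rev_induct) auto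

lemma act_prefix_nonzero:
  "act x (u @ w) \<noteq> z \<Longrightarrow> set w \<subseteq> univ M \<Longrightarrow> act x u \<noteq> z"
  by (metis act_zero foldl_append)

end

section \<open>Algebras without a power law\<close>

text \<open>
  Coordinates for the first construction.  At \<open>Constants c d\<close> all \<open>x\<close>'s are \<open>c\<close> and all \<open>y\<close>'s are
  \<open>d\<close>, so an element with generic values there encodes an identity of \<open>M\<close>.  The
  other two kinds correspond to the rectangles in the partition of the products \<open>x y\<close>: \<open>Index j\<close>
  to those with pairs containing \<open>j\<close>, times \<open>y\<^bsub>j\<^esub>\<close>, and \<open>Index_Pair i k\<close> to \<open>x\<^bsub>ik\<^esub>\<close> times the \<open>y\<close>'s with index outside
  \<open>{i, k}\<close>.  A generator is zero at such a coordinate unless it belongs to a side of the rectangle.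
\<close>

datatype 'a coordinate = Constants 'a 'a | Index nat | Index_Pair nat nat

text \<open>
  If \<open>n'\<close> has the colour of \<open>n\<close> and lies outside \<open>{n, m}\<close>, then \<open>v n = x\<^bsub>nm\<^esub> y\<^bsub>n\<^esub>\<close> has the image of
  \<open>x\<^bsub>nm\<^esub> y\<^bsub>n'\<^esub>\<close>, a product that is the same for all indices outside \<open>{n, m}\<close>.  By symmetry \<open>v m\<close> has
  this image too.

  The generic value at \<open>Constants c d\<close> is \<open>c d\<close>, and it is zero at the other coordinates.  A
  product \<open>x y\<close> is non-zero at the coordinate of its rectangle, and every other word \<open>x y \<dots> y\<close> is
  excluded by the failure of a power law.
\<close>

lemma (in automatic) inherently_non_dualizable_if_no_power_law:
  assumes no_law: "\<And>e. e \<ge> 1 \<Longrightarrow>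
    \<exists>x\<in>univ M. \<exists>y\<in>univ M. act x (replicate (Suc e) y) \<noteq> mul M x y"
  shows "inherently_non_dualizable TYPE('b) TYPE('c::infinite) M"
proof -
  \<comment> \<open>the word \<open>x\<close> alone is covered as well: \<open>c d = c\<close> would give \<open>c d d = c d\<close>\<close>
  have witness: "\<exists>c\<in>Q. \<exists>d\<in>S. act c (replicate n d) \<noteq> mul M c d" if n: "n \<noteq> 1" for n
  proof -
    define e where "e = (if n = 0 then 1 else n - 1)"
    have e: "e \<ge> 1" using n by (auto simp: e_def)
    obtain c d where cd: "c \<in> univ M" "d \<in> univ M" "act c (replicate (Suc e) d) \<noteq> mul M c d"
      using no_law[OF e] by blast
    have "act c (replicate (Suc e) d) = act (mul M c d) (replicate e d)" by simp
    moreover have "act z (replicate e d) = z" using cd by (intro act_zero) auto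
    ultimately have "mul M c d \<noteq> z" using cd(3) by force
    then have "c \<in> Q" "d \<in> S" using mul_cases[OF cd(1,2)] by auto
    moreover have "act c (replicate n d) \<noteq> mul M c d"
    proof (cases "n = 0")
      case True
      then show ?thesis using cd by (auto simp: e_def)
    next
      case False
      then have "Suc e = n" using n by (simp add: e_def)
      then show ?thesis using cd by simp
    qed
    ultimately show ?thesis by blast
  qed
  obtain q a where qa: "q \<in> Q" "a \<in> S" "mul M q a \<noteq> z" "mul M q a \<in> Q"
  proof -
    obtain q a where "q \<in> Q" "a \<in> S" "mul M (mul M q a) a \<noteq> mul M q a"
      using witness[of 2] by (auto simp: numeral_2_eq_2)
    moreover from this have "mul M q a \<noteq> z" using mul_zero(2)[of a] by (metis UnI1 UnI2 univ_eq)
    ultimately show thesis using that mul_cases[of q a] by (auto simp: univ_eq)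
  qed
  \<comment> \<open>coordinates \<open>Constants c d\<close> with \<open>(c, d)\<close> outside \<open>Q \<times> S\<close> just repeat \<open>(q, a)\<close>\<close>
  define x where "x i k = (\<lambda>p. case p of
      Constants c d \<Rightarrow> if c \<in> Q \<and> d \<in> S then c else q
    | Index j \<Rightarrow> if j \<in> {i, k} then q else z
    | Index_Pair i' k' \<Rightarrow> if i' = i \<and> k' = k then q else z)" for i k
  define y where "y j = (\<lambda>p. case p of
      Constants c d \<Rightarrow> if c \<in> Q \<and> d \<in> S then d else a
    | Index j' \<Rightarrow> if j' = j then a else z
    | Index_Pair i k \<Rightarrow> if j \<notin> {i, k} then a else z)" for j
  define G where "G = range (\<lambda>(i, k). x i k) \<union> range y"
  define v where "v n = (\<lambda>p. mul M (x n n p) (y n p))" for n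
  have xG [simp]: "x i k \<in> G" for i k by (auto simp: G_def)
  have yG [simp]: "y j \<in> G" for j by (auto simp: G_def)
  have x_in [simp]: "x i k p \<in> univ M" for i k p
    using qa by (auto simp: x_def univ_eq split: coordinate.splits)
  have y_in [simp]: "y j p \<in> univ M" for j p
    using qa by (auto simp: y_def univ_eq split: coordinate.splits)
  have [simp]: "q \<in> univ M" "a \<in> univ M" using qa by (auto simp: univ_eq)
  have inside: "(\<lambda>p. mul M (x i k p) (y j p)) = v j" if "j \<in> {i, k}" for i j k
    using that by (auto simp: v_def x_def y_def fun_eq_iff split: coordinate.splits)
  have outside: "(\<lambda>p. mul M (x i k p) (y j p)) = (\<lambda>p. mul M (x i k p) (y j' p))"
    if "j \<notin> {i, k}" "j' \<notin> {i, k}" for i j j' k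
    using that by (auto simp: x_def y_def fun_eq_iff split: coordinate.splits)
  show ?thesis
  proof (rule inherently_non_dualizable_if_generic_value_not_attained
      [where M = M and G = G and v = v and 'e = 'b, OF is_magma])
    show "countable G" by (auto simp: G_def)
    show "g i \<in> univ M" if "g \<in> G" for g i using that by (auto simp: G_def)
    show "v n \<in> generated M G" for n
      unfolding v_def by (intro generated.intros) simp_all
  next
    fix N :: "'b magma" assume N: "is_magma N" "finite (univ N)"
    show "\<exists>C :: 'b set. finite C \<and> (\<forall>h\<in>homs (generated_magma M G) N. \<exists>f. range f \<subseteq> C \<and>
        (\<forall>n m n' m'. n \<noteq> m \<longrightarrow> n' \<notin> {n, m} \<longrightarrow> m' \<notin> {n, m} \<longrightarrow> f n' = f n \<longrightarrow> f m' = f m \<longrightarrow>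
          h (v n) = h (v m)))"
    proof (intro exI conjI ballI)
      show "finite (univ N)" by (rule N)
    next
      fix h assume h: "h \<in> homs (generated_magma M G) N"
      have hp: "h (\<lambda>p. mul M (x i k p) (y j p)) = mul N (h (x i k)) (h (y j))" for i j k
        using hom_word[OF h generated.gen, of "x i k" "[y j]"] by simp
      show "range (\<lambda>n. h (y n)) \<subseteq> univ N"
        using h generated.gen[of _ G M] by (auto simp: homs_def generated_magma_def)
      have to_pair: "h (v j) = mul N (h (x i k)) (h (y j'))"
        if "j \<in> {i, k}" "h (y j') = h (y j)" for i j j' k
        using inside[OF that(1)] hp[of i k j] that(2) by simp
      have shift: "mul N (h (x i k)) (h (y j)) = mul N (h (x i k)) (h (y j'))"
        if "j \<notin> {i, k}" "j' \<notin> {i, k}" for i j j' k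
        using outside[OF that] hp by metis
      show "\<forall>n m n' m'. n \<noteq> m \<longrightarrow> n' \<notin> {n, m} \<longrightarrow> m' \<notin> {n, m} \<longrightarrow> h (y n') = h (y n) \<longrightarrow>
          h (y m') = h (y m) \<longrightarrow> h (v n) = h (v m)"
      proof (intro allI impI)
        fix n m n' m'
        assume "n' \<notin> {n, m}" "m' \<notin> {n, m}" "h (y n') = h (y n)" "h (y m') = h (y m)"
        then show "h (v n) = h (v m)"
          using to_pair[of n n m n'] to_pair[of m n m m'] shift[of n' n m m'] by simp
      qed
    qed
  next
    fix f assume "f \<in> generated M G"
    \<comment> \<open>at the coordinates \<open>Constants c d\<close>, only the \<open>y\<close>'s are letters, so only they act non-trivially from the right\<close>
    then have "(\<exists>j. f = y j) \<or>
      (\<exists>i k js. f = (\<lambda>p. act (x i k p) (map (\<lambda>j. y j p) js))) \<or>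
      (\<forall>c\<in>Q. \<forall>d\<in>S. f (Constants c d) = z)" (is "?letter f \<or> ?word f \<or> ?zero f")
    proof induction
      case (gen g)
      have "?word (x i k)" for i k
        by (rule exI[of _ i], rule exI[of _ k], rule exI[of _ "[]"]) simp
      then show ?case using gen by (auto simp: G_def)
    next
      case (prod f g)
      have word_value: "f (Constants c d) \<in> Q \<union> {z}" if w: "?word f" and cd: "c \<in> Q" "d \<in> S" for f c d
      proof -
        obtain i k js where f: "f = (\<lambda>p. act (x i k p) (map (\<lambda>j. y j p) js))" using w by blast
        show ?thesis
        proof (cases js rule: rev_cases)
          case Nil
          then show ?thesis using cd by (simp add: f x_def)
        next
          case (snoc js' j)
          have "act (x i k p) (map (\<lambda>j. y j p) js') \<in> univ M" for p by (rule act_closed) auto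
          then show ?thesis using mul_cases[of _ "y j (Constants c d)"] by (auto simp: f snoc)
        qed
      qed
      have fg_in: "f p \<in> univ M" "g p \<in> univ M" for p
      proof -
        have "h p \<in> univ M" if "h \<in> generated M G" for h
          using that by induction (auto simp: G_def)
        then show "f p \<in> univ M" "g p \<in> univ M" using prod by auto
      qed
      show ?case
      proof (cases "?letter g \<and> ?word f")
        case True
        then obtain i k js j where fg: "f = (\<lambda>p. act (x i k p) (map (\<lambda>j. y j p) js))" "g = y j"
          by blast
        have "?word (\<lambda>p. mul M (f p) (g p))"
          by (rule exI[of _ i], rule exI[of _ k], rule exI[of _ "js @ [j]"]) (simp add: fg)
        then show ?thesis by blast
      next
        case False
        have "mul M (f (Constants c d)) (g (Constants c d)) = z" if cd: "c \<in> Q" "d \<in> S" for c d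
        proof (rule ccontr)
          assume "mul M (f (Constants c d)) (g (Constants c d)) \<noteq> z"
          then have *: "f (Constants c d) \<in> Q" "g (Constants c d) \<in> S"
            using mul_cases[OF fg_in] by auto
          have "\<not> ?letter f"
            using *(1) Q_S cd by (auto simp: y_def)
          moreover have "\<not> ?zero f" "\<not> ?zero g"
            using * zero cd by auto
          moreover have "\<not> ?word g"
          proof
            assume "?word g"
            from word_value[OF this cd] show False using *(2) Q_S zero by auto
          qed
          ultimately have "\<not> ?letter f" "\<not> ?zero f" "\<not> ?zero g" "\<not> ?word g" by blast+
          then show False using False prod.IH by blast
        qed
        then show ?thesis by blast
      qed
    qed
    then consider (letter) j where "f = y j"
      | (word) i k js where "f = (\<lambda>p. act (x i k p) (map (\<lambda>j. y j p) js))"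
      | (zero) "\<forall>c\<in>Q. \<forall>d\<in>S. f (Constants c d) = z" by blast
    then show "\<exists>i. infinite {n. v n i \<noteq> f i}"
    proof cases
      case letter
      then have "v n (Constants q a) \<noteq> f (Constants q a)" for n
        using qa Q_S by (auto simp: v_def x_def y_def)
      then show ?thesis by (intro exI[of _ "Constants q a"]) simp
    next
      case zero
      then have "v n (Constants q a) \<noteq> f (Constants q a)" for n
        using qa by (auto simp: v_def x_def y_def)
      then show ?thesis by (intro exI[of _ "Constants q a"]) simp
    next
      case word
      show ?thesis
      proof (cases "length js = 1")
        case False
        then obtain c d where cd: "c \<in> Q" "d \<in> S" "act c (replicate (length js) d) \<noteq> mul M c d"
          using witness by blast
        then have "v n (Constants c d) \<noteq> f (Constants c d)" for n
          by (auto simp: v_def x_def y_def word map_replicate_const)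
        then show ?thesis by (intro exI[of _ "Constants c d"]) simp
      next
        case True
        then obtain j where js: "js = [j]" by (auto simp: length_Suc_conv)
        show ?thesis
        proof (cases "j \<in> {i, k}")
          case True
          then have "v n (Index j) \<noteq> f (Index j)" if "n \<noteq> j" for n
            using that qa by (auto simp: v_def x_def y_def word js)
          then have "UNIV - {j} \<subseteq> {n. v n (Index j) \<noteq> f (Index j)}" by auto
          moreover have "infinite (UNIV - {j})" by simp
          ultimately show ?thesis using finite_subset by blast
        next
          case False
          then have "v n (Index_Pair i k) \<noteq> f (Index_Pair i k)" for n
            using qa by (auto simp: v_def x_def y_def word js)
          then show ?thesis by (intro exI[of _ "Index_Pair i k"]) simp
        qed
      qed
    qed
  qed
qed


section \<open>Algebras with a non-rectangular pair of words\<close>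

text \<open>
  Write \<open>t i j k\<close> for the product of \<open>x i\<close>, the word \<open>y j\<close>, the letter \<open>w k\<close> and the constant
  remainder of \<open>C\<close>.  Generically \<open>x\<close>, \<open>y\<close> are \<open>q\<^bsub>1\<^esub>\<close>, \<open>A\<close>; the exceptional values at coordinate \<open>p\<close> are
  \<open>q\<^bsub>2\<^esub>\<close> for \<open>x p\<close>, \<open>B\<close> for \<open>y p\<close> and zero for \<open>w p\<close>.  Since \<open>q\<^bsub>2\<^esub> B C = q\<^bsub>1\<^esub> A C\<close>, equal indices
  of \<open>x\<close> and \<open>y\<close> are invisible, and since \<open>q\<^bsub>1\<^esub> B C = 0\<close>, an index of \<open>y\<close> alone produces a zero just
  as an index of \<open>w\<close> does.  These coincidences link all \<open>t n n n\<close> of frequent colour, regardless of the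
  value of \<open>q\<^bsub>2\<^esub> A C\<close>.

  The coordinate \<open>None\<close> carries the generic values, except that all \<open>w k\<close> are zero.  The generic value is
  non-zero at every \<open>Some p\<close> but zero at \<open>None\<close>.  No element \<open>f\<close> looks like this: either some \<open>w k\<close>
  is involved, and \<open>f\<close> has a zero at \<open>Some k\<close>, or \<open>f\<close> agrees at \<open>None\<close> with almost all \<open>Some p\<close>.
\<close>

lemma (in automatic) inherently_non_dualizable_if_not_rectangular:
  assumes q: "q1 \<in> univ M" "q2 \<in> univ M"
    and words: "set A \<subseteq> univ M" "set B \<subseteq> univ M" "set C \<subseteq> univ M" "length A = length B" "C \<noteq> []"
    and diagonal: "act q1 (A @ C) = r" "act q2 (B @ C) = r" "r \<noteq> z"
    and off_diagonal: "act q1 (B @ C) = z"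
  shows "inherently_non_dualizable TYPE('b) TYPE('c::infinite) M"
proof -
  obtain c C' where C: "C = c # C'" using words(5) by (cases C) auto
  let ?L = "length A"
  define x where "x i = (\<lambda>p. if p = Some i then q2 else q1)" for i :: nat
  define y where "y j s = (\<lambda>p. if p = Some j then B ! s else A ! s)" for j s :: nat
  define w where "w k = (\<lambda>p. if p = None \<or> p = Some k then z else c)" for k :: nat
  define u where "u s = (\<lambda>p :: nat option. C' ! s)" for s
  define word where "word j k = map (y j) [0..<?L] @ [w k] @ map u [0..<length C']" for j k
  define t where "t i j k = (\<lambda>p. act (x i p) (map (\<lambda>g. g p) (word j k)))" for i j k
  define G where "G = range x \<union> (\<Union>j. y j ` {..<?L}) \<union> range w \<union> u ` {..<length C'}"
  have xG: "x i \<in> G" and wG: "w k \<in> G" and yG: "s < ?L \<Longrightarrow> y j s \<in> G"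
    and uG: "s < length C' \<Longrightarrow> u s \<in> G" for i j k s
    unfolding G_def by blast+
  have wordG: "set (word j k) \<subseteq> G" for j k
    using wG yG uG by (auto simp: word_def)
  have G_in: "g p \<in> univ M" if "g \<in> G" for g p
    using that q words unfolding G_def C x_def y_def w_def u_def
    by (auto simp: subset_iff)
  have t_None: "t i j k None = z" for i j k
    unfolding t_def
  proof (rule act_zero_letter)
    show "x i None \<in> univ M" "set (map (\<lambda>g. g None) (word j k)) \<subseteq> univ M"
      using xG wordG G_in by fastforce+
    show "z \<in> set (map (\<lambda>g. g None) (word j k))" by (simp add: word_def w_def)
  qed
  have t_Some: "t i j k (Some p) = (if p = k then z
      else if p = j then (if p = i then r else z)
      else (if p = i then act q2 (A @ C) else r))" for i j k p
  proof (cases "p = k")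
    case True
    have "t i j k (Some p) = z"
      unfolding t_def
    proof (rule act_zero_letter)
      show "x i (Some p) \<in> univ M" "set (map (\<lambda>g. g (Some p)) (word j k)) \<subseteq> univ M"
        using xG wordG G_in by fastforce+
      show "z \<in> set (map (\<lambda>g. g (Some p)) (word j k))" by (simp add: word_def w_def True)
    qed
    then show ?thesis using True by simp
  next
    case False
    have "map (\<lambda>g. g (Some p)) (word j k) = (if p = j then B else A) @ C"
      using False words(4) map_nth[of A] map_nth[of B] map_nth[of C']
      by (simp add: word_def y_def w_def u_def C comp_def)
    then show ?thesis using False diagonal off_diagonal by (simp add: t_def x_def)
  qed
  have t_eqI: "t i j k = t i' j' k'" if "\<And>p. t i j k (Some p) = t i' j' k' (Some p)" for i j k i' j' k'
  proof
    show "t i j k p = t i' j' k' p" for p using that by (cases p) (simp_all add: t_None)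
  qed
  have t_iik: "t i i k = t k k k" and t_swap: "i \<notin> {j, k} \<Longrightarrow> j \<noteq> k \<Longrightarrow> t i j k = t i k j"
    and t_kjk: "j \<noteq> k \<Longrightarrow> t k j k = t j k j" for i j k
    by (rule t_eqI, auto simp: t_Some)+
  define v where "v n = t n n n" for n
  show ?thesis
  proof (rule inherently_non_dualizable_if_generic_value_not_attained
      [where M = M and G = G and v = v and 'e = "'b list", OF is_magma])
    show "countable G" by (auto simp: G_def)
    show "g p \<in> univ M" if "g \<in> G" for g p using that by (rule G_in)
    show "v n \<in> generated M G" for n
      unfolding v_def t_def by (rule generated_word[OF generated.gen[OF xG] wordG])
  next
    fix N :: "'b magma" assume N: "is_magma N" "finite (univ N)"
    let ?C = "{xs. set xs \<subseteq> univ N \<and> length xs = ?L + 2}"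
    show "\<exists>C :: 'b list set. finite C \<and> (\<forall>h\<in>homs (generated_magma M G) N. \<exists>f. range f \<subseteq> C \<and>
        (\<forall>n m n' m'. n \<noteq> m \<longrightarrow> n' \<notin> {n, m} \<longrightarrow> m' \<notin> {n, m} \<longrightarrow> f n' = f n \<longrightarrow> f m' = f m \<longrightarrow>
          h (v n) = h (v m)))"
    proof (intro exI conjI ballI)
      show "finite ?C" using N(2) by (rule finite_lists_length_eq)
    next
      fix h assume h: "h \<in> homs (generated_magma M G) N"
      have h_in: "h g \<in> univ N" if "g \<in> G" for g
        using h generated.gen[OF that] by (auto simp: homs_def generated_magma_def)
      let ?f = "\<lambda>n. [h (x n), h (w n)] @ map h (map (y n) [0..<?L])"
      define T where "T a b d = foldl (mul N) a (b @ [d] @ map h (map u [0..<length C']))" for a b d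
      have ht: "h (t i j k) = T (h (x i)) (map h (map (y j) [0..<?L])) (h (w k))" for i j k
        unfolding t_def hom_word[OF h generated.gen[OF xG] wordG] by (simp add: T_def word_def)
      have ht_eq: "h (t i j k) = h (t i' j' k')" if "?f i = ?f i'" "?f j = ?f j'" "?f k = ?f k'"
        for i j k i' j' k'
        using that unfolding ht append_Cons append_Nil list.inject by (simp only:)
      show "range ?f \<subseteq> ?C"
        using h_in[OF xG] h_in[OF wG] h_in[OF yG] by auto
      show "\<forall>n m n' m'. n \<noteq> m \<longrightarrow> n' \<notin> {n, m} \<longrightarrow> m' \<notin> {n, m} \<longrightarrow> ?f n' = ?f n \<longrightarrow> ?f m' = ?f m \<longrightarrow>
          h (v n) = h (v m)"
      proof (intro allI impI)
        fix n m n' m'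
        assume nm: "n \<noteq> m" "n' \<notin> {n, m}" "m' \<notin> {n, m}" and f: "?f n' = ?f n" "?f m' = ?f m"
        have "h (v m) = h (t n n m)" using t_iik[of n m] by (simp add: v_def)
        also have "\<dots> = h (t n' n m)" by (rule ht_eq) (simp_all only: f)
        also have "\<dots> = h (t n' m n)" using t_swap[of n' n m] nm by simp
        also have "\<dots> = h (t n m n)" by (rule ht_eq) (simp_all only: f)
        also have "\<dots> = h (t m n m)" using t_kjk[of m n] nm by simp
        also have "\<dots> = h (t m' n m)" by (rule ht_eq) (simp_all only: f)
        also have "\<dots> = h (t m' m n)" using t_swap[of m' n m] nm by simp
        also have "\<dots> = h (t m m n)" by (rule ht_eq) (simp_all only: f)
        also have "\<dots> = h (v n)" using t_iik[of m n] by (simp add: v_def)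
        finally show "h (v n) = h (v m)" by simp
      qed
    qed
  next
    fix f assume f: "f \<in> generated M G"
    have in_M: "f p \<in> univ M" if "f \<in> generated M G" for f p
      using that by induction (auto simp: G_in)
    from f have "(\<exists>k. f (Some k) = z) \<or> finite {k. f (Some k) \<noteq> f None}"
    proof induction
      case (gen g)
      have "finite {k. x i (Some k) \<noteq> x i None}" for i
        by (rule finite_subset[of _ "{i}"]) (auto simp: x_def)
      moreover have "finite {k. y j s (Some k) \<noteq> y j s None}" for j s
        by (rule finite_subset[of _ "{j}"]) (auto simp: y_def)
      moreover have "w k (Some k) = z" for k by (simp add: w_def)
      moreover have "finite {k. u s (Some k) \<noteq> u s None}" for s by (simp add: u_def)
      ultimately show ?case using gen unfolding G_def by blast
    next
      case (prod f g)
      show ?case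
      proof (cases "\<exists>k. f (Some k) = z \<or> g (Some k) = z")
        case True
        then show ?thesis using in_M prod.hyps mul_zero by metis
      next
        case False
        then have "finite ({k. f (Some k) \<noteq> f None} \<union> {k. g (Some k) \<noteq> g None})"
          using prod.IH by simp
        then have "finite {k. mul M (f (Some k)) (g (Some k)) \<noteq> mul M (f None) (g None)}"
          by (rule rev_finite_subset) auto
        then show ?thesis by blast
      qed
    qed
    moreover have "\<exists>p. infinite {n. v n p \<noteq> f p}" if "f (Some k) = z" for k
    proof -
      have "v n (Some k) \<noteq> f (Some k)" if "n \<noteq> k" for n
        using that \<open>f (Some k) = z\<close> diagonal(3) by (simp add: v_def t_Some)
      then have "UNIV - {k} \<subseteq> {n. v n (Some k) \<noteq> f (Some k)}" by auto
      moreover have "infinite (UNIV - {k})" by simp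
      ultimately show ?thesis using finite_subset by blast
    qed
    moreover have "\<exists>p. infinite {n. v n p \<noteq> f p}" 
      if fin: "finite {k. f (Some k) \<noteq> f None}" and nz: "\<nexists>k. f (Some k) = z"
    proof -
      obtain k where "f (Some k) = f None"
        using ex_new_if_finite[OF infinite_UNIV_nat fin] by blast
      then have "v n None \<noteq> f None" for n using nz by (metis t_None v_def)
      then show ?thesis by (intro exI[of _ None]) simp
    qed
    ultimately show "\<exists>p. infinite {n. v n p \<noteq> f p}" by blast
  qed
qed

section \<open>Rectangular algebras with a power law\<close>

text \<open>
  By the power law, \<open>c\<^bsup>e\<^esup>\<close> fixes every state of the form \<open>s c\<close>.  So a path ending in \<open>\<rho> = s c\<close>
  has a competitor of the same length \<open>n\<close> that reads only \<open>c\<close> and ends in \<open>\<rho>\<close>; it starts in the state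
  that one would call \<open>\<rho> c\<^bsup>-n\<^esup>\<close>, namely \<open>\<rho> c\<^bsup>ne-n\<^esup>\<close>.  Rectangularity allows either path to be
  read from the starting state of the other.
\<close>

lemma (in automatic) letters_permute_if_rectangular:
  assumes finite: "finite (univ M)"
    and e: "e \<ge> 1"
    and power_law: "\<And>x y. x \<in> univ M \<Longrightarrow> y \<in> univ M \<Longrightarrow> act x (replicate (Suc e) y) = mul M x y"
    and rectangular: "\<And>q1 q2 A B C. \<lbrakk>q1 \<in> univ M; q2 \<in> univ M;
        set A \<subseteq> univ M; set B \<subseteq> univ M; set C \<subseteq> univ M; length A = length B; C \<noteq> [];
        act q1 (A @ C) = act q2 (B @ C); act q1 (A @ C) \<noteq> z\<rbrakk> \<Longrightarrow> act q1 (B @ C) \<noteq> z"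
    and x: "x \<in> univ M" and V: "set V \<subseteq> univ M" "act x V \<noteq> z"
    and D: "length D = length V" "set D \<subseteq> set V"
  shows "act x D \<noteq> z"
proof (cases "V = []")
  case True
  then show ?thesis using V D by simp
next
  case V_ne: False
  have power: "act (mul M x c) (replicate (k * e) c) = mul M x c" if "x \<in> univ M" "c \<in> univ M" for x c k
  proof (induction k)
    case (Suc k)
    have "act (mul M x c) (replicate e c) = mul M x c" using power_law[OF that] by simp
    then show ?case using Suc by (simp add: replicate_add)
  qed simp

  \<comment> \<open>a letter can be read at once if it can be read later on\<close>
  have move_front: "\<exists>m. act (mul M x c) (replicate m c @ W2) \<noteq> z"
    if "x \<in> univ M" "set W1 \<subseteq> univ M" "c \<in> univ M" "set W2 \<subseteq> univ M" "act x (W1 @ [c] @ W2) \<noteq> z"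
    for x c W1 W2
  proof -
    let ?L = "Suc (length W1)"
    define \<rho> where "\<rho> = act x (W1 @ [c])"
    have \<rho>: "\<rho> = mul M (act x W1) c" "\<rho> \<in> univ M" using that by (simp_all add: \<rho>_def)
    let ?q2 = "act \<rho> (replicate (?L * e - ?L) c)" and ?C = "replicate e c @ W2"
    have stay: "act \<rho> (replicate (k * e) c) = \<rho>" for k
      using power[of "act x W1" c k] that \<rho> by simp
    have "?L \<le> ?L * e" using e by (metis mult.right_neutral mult_le_mono2)
    then have "replicate (?L * e - ?L) c @ replicate ?L c = replicate (?L * e) c"
      by (simp only: replicate_add[symmetric] le_add_diff_inverse2)
    then have q2: "act ?q2 (replicate ?L c) = \<rho>" using stay[of ?L] by (metis foldl_append)
    have q1: "act x ((W1 @ [c]) @ ?C) = act \<rho> W2"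
      using stay[of 1] by (simp add: \<rho>_def)
    have "act x (replicate ?L c @ ?C) \<noteq> z"
    proof (rule rectangular[of x ?q2 "W1 @ [c]"])
      show "act x ((W1 @ [c]) @ ?C) = act ?q2 (replicate ?L c @ ?C)"
        using q1 q2 stay[of 1] by (simp del: replicate.simps)
      show "act x ((W1 @ [c]) @ ?C) \<noteq> z" using that q1 by (simp add: \<rho>_def)
      show "?q2 \<in> univ M" using \<rho> that by (intro act_closed) auto
    qed (use that e in \<open>auto split: if_splits\<close>)
    then have "act (mul M x c) (replicate (length W1 + e) c @ W2) \<noteq> z"
      by (simp add: replicate_add)
    then show ?thesis by blast
  qed

  define c where "c = last V"
  define Y where "Y = replicate (length V * e - length V) c"
  define Z where "Z = Y @ V"
  have cV: "c \<in> set V" using V_ne by (simp add: c_def)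
  have Z: "set Z \<subseteq> univ M" "set V \<subseteq> set Z" using cV V by (auto simp: Z_def Y_def)
  \<comment> \<open>after \<open>V\<close>, one can read \<open>V\<close> again, preceded by some repetitions of its last letter\<close>
  have reread: "act (act x V) Z \<noteq> z" if x: "x \<in> univ M" and nz: "act x V \<noteq> z" for x
  proof -
    let ?n = "length V"
    let ?r = "act x V"
    have last: "?r = mul M (act x (butlast V)) c"
      using V_ne unfolding c_def by (metis append_butlast_last_id foldl_Cons foldl_Nil foldl_append)
    have "set (butlast V) \<subseteq> univ M" using V by (meson in_set_butlastD subset_iff)
    then have stay: "act ?r (replicate (k * e) c) = ?r" for k
      using power[of "act x (butlast V)" c k] x cV V by (auto simp: last)
    have "?n \<le> ?n * e" using e by (metis mult.right_neutral mult_le_mono2)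
    then have "Y @ replicate ?n c = replicate (?n * e) c"
      unfolding Y_def by (simp only: replicate_add[symmetric] le_add_diff_inverse2)
    then have Y: "act (act ?r Y) (replicate ?n c) = ?r" using stay[of ?n] by (metis foldl_append)
    have c_in: "c \<in> univ M" using cV V by blast
    have "act (act ?r Y) (V @ replicate e c) \<noteq> z"
    proof (rule rectangular[of _ x "replicate ?n c"])
      show "act ?r Y \<in> univ M" using x V c_in by (intro act_closed) (auto simp: Y_def)
      show "act (act ?r Y) (replicate ?n c @ replicate e c) = act x (V @ replicate e c)"
        "act (act ?r Y) (replicate ?n c @ replicate e c) \<noteq> z"
        using Y stay[of 1] nz by simp_all
    qed (use x V c_in e in auto)
    moreover have "set (replicate e c) \<subseteq> univ M" using c_in by auto
    ultimately have "act (act ?r Y) V \<noteq> z" by (rule act_prefix_nonzero)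
    then show ?thesis by (simp add: Z_def)
  qed
  let ?r = "act x V"
  have r_in: "?r \<in> univ M" using x V by simp
  have pump: "act ?r (concat (replicate n Z)) \<noteq> z" for n
  proof -
    have "\<exists>x'\<in>univ M. act ?r (concat (replicate n Z)) = act x' V \<and> act x' V \<noteq> z"
    proof (induction n)
      case 0
      then show ?case using x V by auto
    next
      case (Suc n)
      then obtain x' where x': "x' \<in> univ M" "act ?r (concat (replicate n Z)) = act x' V" "act x' V \<noteq> z"
        by blast
      have "concat (replicate (Suc n) Z) = concat (replicate n Z) @ Z"
        by (metis append_Nil2 concat.simps concat_append replicate_Suc replicate_append_same)
      then have "act ?r (concat (replicate (Suc n) Z)) = act (act (act x' V) Y) V"
        using x' by (simp add: Z_def)
      moreover have "act (act (act x' V) Y) V \<noteq> z" using reread[OF x'(1,3)] by (simp add: Z_def)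
      moreover have "act (act x' V) Y \<in> univ M" using x' V cV by (intro act_closed) (auto simp: Y_def)
      ultimately show ?case by metis
    qed
    then show ?thesis by auto
  qed
  \<comment> \<open>each block \<open>Z\<close> ahead pays for one letter of \<open>W\<close>: moving it to the front destroys only that block\<close>
  have read: "act x W \<noteq> z"
    if "x \<in> univ M" "set P \<subseteq> univ M" "act x (P @ concat (replicate (length W) Z)) \<noteq> z" "set W \<subseteq> set Z"
    for x P W
    using that
  proof (induction W arbitrary: x P)
    case Nil
    then show ?case by auto
  next
    case (Cons d W)
    let ?W = "concat (replicate (length W) Z)"
    have "d \<in> set Z" using Cons.prems by simp
    then obtain Z1 Z2 where Z12: "Z = Z1 @ [d] @ Z2" by (metis append_Cons append_Nil split_list)
    have W_in: "set ?W \<subseteq> univ M" using Z by auto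
    have "\<exists>m. act (mul M x d) (replicate m d @ (Z2 @ ?W)) \<noteq> z"
      by (rule move_front[of x "P @ Z1"]) (use Cons.prems W_in Z in \<open>auto simp: Z12\<close>)
    then obtain m where m: "act (mul M x d) ((replicate m d @ Z2) @ ?W) \<noteq> z" by auto
    have "d \<in> univ M" using \<open>d \<in> set Z\<close> Z by blast
    then have "act (mul M x d) W \<noteq> z"
      by (intro Cons.IH[OF _ _ m]) (use Cons.prems Z in \<open>auto simp: Z12\<close>)
    then show ?case by simp
  qed
  have D_in: "set D \<subseteq> univ M" and D_Z: "set D \<subseteq> set Z" using D V Z by auto
  \<comment> \<open>\<open>D\<close> is read at least once, since the common continuation must be non-empty\<close>
  define s where "s n = act ?r (concat (replicate (Suc n) D))" for n
  have s_nonzero: "s n \<noteq> z" for n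
    unfolding s_def
    by (rule read[OF r_in, of "[]"]) (use pump D_Z in auto)
  have s_in: "s n \<in> univ M" for n
    unfolding s_def by (rule act_closed[OF r_in]) (use D_in in auto)
  have "\<not> inj s"
    using finite s_in finite_subset[of "range s" "univ M"] range_inj_infinite[of s] by auto
  then obtain i j where ij: "i < j" "s i = s j"
    unfolding inj_def by (metis linorder_neqE_nat)
  \<comment> \<open>from \<open>?q2\<close>, the word \<open>D\<close> leads to a state that \<open>?C\<close> takes to the same state as \<open>?r\<close>\<close>
  let ?C = "concat (replicate (Suc i) D)"
  let ?q2 = "act ?r (concat (replicate (j - Suc i) D))"
  have "act x (D @ ?C) \<noteq> z"
  proof (rule rectangular[of x ?q2 V])
    have "concat (replicate (j - Suc i) D) @ D @ ?C =
        concat (replicate (j - Suc i) D @ replicate (Suc (Suc i)) D)" by simp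
    also have "\<dots> = concat (replicate (j - Suc i + Suc (Suc i)) D)" by (simp only: replicate_add)
    also have "j - Suc i + Suc (Suc i) = Suc j" using ij by simp
    finally have "act ?q2 (D @ ?C) = s j" unfolding s_def by (metis foldl_append)
    then show "act x (V @ ?C) = act ?q2 (D @ ?C)" using ij by (simp add: s_def)
    show "act x (V @ ?C) \<noteq> z" using s_nonzero[of i] by (simp add: s_def)
    show "?q2 \<in> univ M" by (rule act_closed[OF r_in]) (use D_in in auto)
  qed (use x V D D_in V_ne in auto)
  moreover have "set ?C \<subseteq> univ M" using D_in by auto
  ultimately show ?thesis by (rule act_prefix_nonzero)
qed

section \<open>Permuting the letters of a word\<close>

theorem theorem2p7:
  fixes M :: "'a magma" and Q S :: "'a set" and z :: 'a
    and m :: nat and \<phi> :: "nat \<Rightarrow> nat"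
  assumes "automatic_algebra Q S z M"
    and "finite (univ M)"
    and "m \<ge> 1"
    and "\<phi> permutes {1..m}"
    and "\<not> satisfies_perm_quasi_eq M z m \<phi>"
  shows "inherently_non_dualizable TYPE('b) TYPE('c::infinite) M"
proof -
  interpret automatic Q S z M by unfold_locales (rule assms(1))
  obtain x y where x: "x \<in> univ M" and y: "y \<in> {1..m} \<rightarrow> univ M"
    and zero: "left_prod M m x y = z" and nonzero: "left_prod M m x (\<lambda>i. y (\<phi> i)) \<noteq> z"
    using assms(5) by (auto simp: satisfies_perm_quasi_eq_def)
  define V D where "V = map (\<lambda>i. y (\<phi> i)) [1..<Suc m]" and "D = map y [1..<Suc m]"
  have "set [1..<Suc m] = {1..m}" by auto
  moreover have "\<phi> ` {1..m} = {1..m}" using assms(4) by (rule permutes_image)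
  ultimately have sets: "set D = y ` {1..m}" "set V = y ` {1..m}"
    unfolding V_def D_def set_map by (simp_all only: image_image[symmetric])
  then have VD: "set D = set V" "set V \<subseteq> univ M" "length D = length V"
    using y by (auto simp: V_def D_def)
  have acts: "act x V \<noteq> z" "act x D = z"
    using zero nonzero by (simp_all add: left_prod_def V_def D_def)
  show ?thesis
  proof (cases "\<exists>e\<ge>1. \<forall>x\<in>univ M. \<forall>y\<in>univ M. act x (replicate (Suc e) y) = mul M x y")
    case False
    then show ?thesis by (intro inherently_non_dualizable_if_no_power_law) blast
  next
    case True
    then obtain e where e: "e \<ge> 1"
      and law: "\<And>x y. x \<in> univ M \<Longrightarrow> y \<in> univ M \<Longrightarrow> act x (replicate (Suc e) y) = mul M x y"
      by blast
    show ?thesis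
    proof (rule ccontr)
      assume dual: "\<not> ?thesis"
      have "act x D \<noteq> z"
      proof (rule letters_permute_if_rectangular[OF assms(2) e law _ x VD(2) acts(1) VD(3)])
        fix q1 q2 A B C
        assume *: "q1 \<in> univ M" "q2 \<in> univ M" "set A \<subseteq> univ M" "set B \<subseteq> univ M" "set C \<subseteq> univ M"
          "length A = length B" "C \<noteq> []" "act q1 (A @ C) = act q2 (B @ C)" "act q1 (A @ C) \<noteq> z"
        show "act q1 (B @ C) \<noteq> z"
        proof
          assume "act q1 (B @ C) = z"
          then have "inherently_non_dualizable TYPE('b) TYPE('c) M"
            by (rule inherently_non_dualizable_if_not_rectangular
                [OF *(1-7) refl *(8)[symmetric] *(9)])
          then show False using dual by blast
        qed
      qed (use VD in auto)
      then show False using acts by simp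
    qed
  qed
qed

end
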